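(* Let $(A,b): x\in\mathbb{R}^n\mapsto Ax+b\in\mathbb{R}^n$ be an affine map and let $v\in\mathbb{R}^n$. Assume that for $\alpha\in(0,1)$ the value $1-\alpha$ is not an eigenvalue of $A$, i.e. that the matrix $A_\alpha:=\alpha^{-1}\left(A+(\alpha-1)\mathbb{1}\right)$ is invertible. Then the following statements hold. (a) There is a unique polygon $x=(x_j)_{j\in\mathbb{Z}}$ in $\mathbb{R}^n$ with $x_0=v$ which is a soliton of $M_\alpha$ (i.e. affinely invariant under $M_\alpha$) with respect to the affine map $(A,b)$, i.e. with $(1-\alpha)x_j+\alpha x_{j+1}=Ax_j+b$ for all $j\in\mathbb{Z}$. If $b_\alpha=\alpha^{-1}b$, then for $j>0$: $$x_j=A_\alpha^j(v)+A_\alpha^{j-1}(b_\alpha)+\dots+A_\alpha(b_\alpha)+b_\alpha =v+\left(A_\alpha^j-\mathbb{1}\right)\left(v+(A_\alpha-\mathbb{1})^{-1}(b_\alpha)\right),$$ and for $j<0$: $$x_j=A_\alpha^{j}(v)-\left(A_\alpha^{j}(b_\alpha)+\dots+A_\alpha^{-1}(b_\alpha)\right) =v+\left(A_\alpha^j-\mathbb{1}\right)\left(v-(A_\alpha^{-1}-\mathbb{1})^{-1}\left(A_\alpha^{-1}(b_\alpha)\right)\right).$$ (b) If $A_\alpha=\exp(B_\alpha)$ for an $(n,n)$-matrix $B_\alpha$ and if $b_\alpha=F_{B_\alpha}(1)(d_\alpha)$ for a vector $d_\alpha\in\mathbb{R}^n$, then the polygon $x_j$ lies on the smooth curve $$c(t)=v+F_{B_\alpha}(t)\left(B_\alpha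 v+d_\alpha\right),$$ i.e. $x_j=c(j)$ for all $j\in\mathbb{Z}$.
   Context: The affine group $\mathrm{Aff}(n)$ is the group of affine maps $(A,b):x\mapsto Ax+b$ of $\mathbb{R}^n$ with $A\in\mathrm{GL}(n)$ an invertible real matrix and $b\in\mathbb{R}^n$; $\mathbb{1}$ is the identity matrix. A polygon in $\mathbb{R}^n$ is a family $x=(x_j)_{j\in\mathbb{Z}}$ of points of $\mathbb{R}^n$. For $\alpha\in(0,1)$ the map $M_\alpha$ sends a polygon $x$ to the polygon $(M_\alpha(x))_j=(1-\alpha)x_j+\alpha x_{j+1}$. A polygon $x$ is a soliton of $M_\alpha$ with respect to $(A,b)\in\mathrm{Aff}(n)$ if $(M_\alpha(x))_j=Ax_j+b$ for all $j\in\mathbb{Z}$. For a real $(n,n)$-matrix $B$ and $t\in\mathbb{R}$, $F_B(t)=\sum_{k=1}^\infty \frac{t^k}{k!}B^{k-1}$.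
   Formalization: The second expressions for x_j are asserted only when the inverse they contain, of A_α − 1 (for j>0) or of A_α^{-1} − 1 (for j<0), exists; for example with A the identity, A_α − 1 = 0 and they are undefined. *)

theory Defs
  imports "HOL-Analysis.Analysis"
begin

type_synonym 'n polygon = "int \<Rightarrow> real ^ 'n"

definition midpoint_map :: "real \<Rightarrow> 'n::finite polygon \<Rightarrow> 'n polygon" where
  "midpoint_map \<alpha> x = (\<lambda>j. (1 - \<alpha>) *\<^sub>R x j + \<alpha> *\<^sub>R x (j + 1))"

(* Invertibility of A is not built in: the notion makes sense for every affine map x \<mapsto> A x + b. *)
definition soliton :: "real \<Rightarrow> real ^ 'n ^ 'n \<Rightarrow> real ^ 'n \<Rightarrow> 'n::finite polygon \<Rightarrow> bool" where
  "soliton \<alpha> A b x \<longleftrightarrow> (\<forall>j. midpoint_map \<alpha> x j = A *v x j + b)"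

definition eigenvalue :: "real ^ 'n ^ 'n::finite \<Rightarrow> real \<Rightarrow> bool" where
  "eigenvalue A \<mu> \<longleftrightarrow> (\<exists>w. w \<noteq> 0 \<and> A *v w = \<mu> *\<^sub>R w)"

(* The class operations times, power and exp are not usable on real ^ 'n ^ 'n, where
   times is the componentwise product; hence the powers and series are built from (**). *)
primrec matrix_power :: "real ^ 'n ^ 'n::finite \<Rightarrow> nat \<Rightarrow> real ^ 'n ^ 'n" where
  "matrix_power B 0 = mat 1"
| "matrix_power B (Suc k) = B ** matrix_power B k"

definition matrix_powi :: "real ^ 'n ^ 'n::finite \<Rightarrow> int \<Rightarrow> real ^ 'n ^ 'n" where
  "matrix_powi B j =
     (if j \<ge> 0 then matrix_power B (nat j) else matrix_power (matrix_inv B) (nat (- j)))"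

definition matrix_exp :: "real ^ 'n ^ 'n::finite \<Rightarrow> real ^ 'n ^ 'n" where
  "matrix_exp B = (\<Sum>k. (1 / fact k) *\<^sub>R matrix_power B k)"

(* F_B(t) is the sum over k \<ge> 1 of t^k / k! B^(k-1); the index is shifted to start at 0. *)
definition F_series :: "real ^ 'n ^ 'n::finite \<Rightarrow> real \<Rightarrow> real ^ 'n ^ 'n" where
  "F_series B t = (\<Sum>k. (t ^ Suc k / fact (Suc k)) *\<^sub>R matrix_power B k)"

definition smooth_curve :: "(real \<Rightarrow> 'a::real_normed_vector) \<Rightarrow> bool" where
  "smooth_curve c \<longleftrightarrow>
     (\<forall>k t. ((\<lambda>f s. vector_derivative f (at s)) ^^ k) c differentiable (at t))"

end

theory Submission
  imports Defs
begin

text \<open>Dividing by \<open>\<alpha>\<close> turns the soliton equation into the recursion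
  \<open>x (j + 1) = A\<^sub>\<alpha> x j + b\<^sub>\<alpha>\<close>, whose two-sided solutions are determined by \<open>x 0\<close> because
  \<open>A\<^sub>\<alpha>\<close> is invertible; each closed form is then verified by checking the recursion.
  For the curve, \<open>F\<^sub>B' = 1 + B F\<^sub>B\<close> gives smoothness, and
  \<open>h(t) = c(t + 1) - (A\<^sub>\<alpha> c(t) + b\<^sub>\<alpha>)\<close> solves \<open>h' = B h\<close> with \<open>h(0) = 0\<close>, so it vanishes.\<close>

section \<open>Affine recursions over the integers\<close>

lemma matrix_inv_cancel:
  fixes A :: "real^'n^'n"
  assumes "invertible A"
  shows "A ** matrix_inv A = mat 1" "matrix_inv A ** A = mat 1"
  using someI_ex[OF assms[unfolded invertible_def]] by (simp_all add: matrix_inv_def)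

lemma invertible_iff_ker_trivial:
  fixes A :: "real^'n^'n"
  shows "invertible A \<longleftrightarrow> (\<forall>w. A *v w = 0 \<longrightarrow> w = 0)"
  by (simp add: invertible_left_inverse matrix_left_invertible_ker)

lemma matrix_powi_0 [simp]: "matrix_powi A 0 = mat 1"
  by (simp add: matrix_powi_def)

text \<open>For a negative exponent, \<open>A\<close> cancels the leading factor
  \<open>matrix_inv A\<close> of the power. Together with the value at 0, this is the law of
  exponents on which all recursions below rest.\<close>

lemma matrix_powi_add_1:
  assumes "invertible A"
  shows "matrix_powi A (j + 1) = A ** matrix_powi A j"
proof (cases "j \<ge> 0")
  case True
  then show ?thesis by (simp add: matrix_powi_def nat_add_distrib)
next
  case False
  then obtain m where j: "j = - int (Suc m)"
    by (metis int_cases2 linorder_not_le negative_zle not0_implies_Suc of_nat_0 neg_0_equal_iff_equal order_refl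
        of_nat_0_le_iff)
  then have "matrix_powi A j = matrix_inv A ** matrix_power (matrix_inv A) m"
    by (simp add: matrix_powi_def nat_add_distrib)
  moreover have "matrix_powi A (j + 1) = matrix_power (matrix_inv A) m"
    using j by (cases m) (simp_all add: matrix_powi_def nat_add_distrib)
  ultimately show ?thesis
    by (simp add: matrix_mul_assoc matrix_inv_cancel[OF assms])
qed

text \<open>Two-sided induction from 0: forwards the recursion determines the next value, backwards
  the injectivity of \<open>A\<close> does. The closed forms and the curve are all identified with
  the polygon in this way.\<close>

lemma affine_recursion_unique:
  fixes A :: "real^'n^'n"
  assumes "invertible A"
    and "\<And>j. x (j + 1) = A *v x j + b" "\<And>j. y (j + 1) = A *v y j + b"
    and "x 0 = y 0"
  shows "x j = y (j::int)"
proof (induction j rule: int_induct[where k = 0])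
  case base
  show ?case by fact
next
  case (step1 i)
  then show ?case using assms(2,3) by simp
next
  case (step2 i)
  have "A *v x (i - 1) = A *v y (i - 1)"
    using assms(2)[of "i - 1"] assms(3)[of "i - 1"] step2 by simp
  then have "A *v (x (i - 1) - y (i - 1)) = 0"
    by (simp add: matrix_vector_mult_diff_distrib)
  then show ?case
    using assms(1) by (auto simp: invertible_iff_ker_trivial)
qed

text \<open>Both first closed forms in one expression, so that a single recursion can be checked
  over all integers. At \<open>j = 0\<close> the interval \<open>{0..j-1}\<close> is empty.\<close>

definition affine_orbit :: "real^'n^'n \<Rightarrow> real^'n \<Rightarrow> real^'n \<Rightarrow> int \<Rightarrow> real^'n::finite" where
  "affine_orbit A b v j = matrix_powi A j *v v +
     (if j \<ge> 0 then \<Sum>k\<in>{0..j-1}. matrix_powi A k *v b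
      else - (\<Sum>k\<in>{j..-1}. matrix_powi A k *v b))"

lemma affine_orbit_0 [simp]: "affine_orbit A b v 0 = v"
  by (simp add: affine_orbit_def)

text \<open>Applying \<open>A\<close> raises every exponent in the sum by one. The added
  \<open>b\<close> is the term with exponent 0: for nonnegative \<open>j\<close> it fills the gap
  left at the bottom, for negative \<open>j\<close> it cancels the top term of the subtracted
  sum.\<close>

lemma affine_orbit_add_1:
  assumes "invertible A"
  shows "affine_orbit A b v (j + 1) = A *v affine_orbit A b v j + b"
proof -
  let ?p = "\<lambda>k. matrix_powi A k *v b"
  have shift: "A *v (\<Sum>k\<in>{m..n}. ?p k) = (\<Sum>k\<in>{m+1..n+1}. ?p k)" for m n
  proof -
    have "A *v (\<Sum>k\<in>{m..n}. ?p k) = (\<Sum>k\<in>{m..n}. ?p (k + 1))"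
      by (simp add: linear_sum[OF matrix_vector_mul_linear] matrix_powi_add_1[OF assms]
          matrix_vector_mul_assoc o_def)
    also have "\<dots> = (\<Sum>k\<in>{m+1..n+1}. ?p k)"
      by (rule sum.reindex_bij_witness[of _ "\<lambda>k. k - 1" "\<lambda>k. k + 1"]) auto
    finally show ?thesis .
  qed
  have b: "?p 0 = b" by simp
  \<comment> \<open>The case \<open>j = -1\<close> stands apart because \<open>j + 1\<close> then
    falls into the other branch of \<open>affine_orbit\<close>.\<close>
  consider "j \<ge> 0" | "j = -1" | "j < -1" by linarith
  then show ?thesis
  proof cases
    case 1
    have "{0..j} = insert 0 {1..j}" using 1 by auto
    then have "(\<Sum>k\<in>{0..j}. ?p k) = b + (\<Sum>k\<in>{1..j}. ?p k)" by simp
    then show ?thesis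
      using 1 shift[of 0 "j - 1"]
      by (simp add: affine_orbit_def matrix_powi_add_1[OF assms] matrix_vector_mul_assoc
          matrix_vector_right_distrib)
  next
    case 2
    then show ?thesis
      using shift[of "-1" "-1"] matrix_powi_add_1[OF assms, of "-1"]
      by (simp add: affine_orbit_def matrix_vector_mul_assoc matrix_vector_mult_diff_distrib)
  next
    case 3
    have "{j+1..0} = insert 0 {j+1..-1}" using 3 by auto
    then have "(\<Sum>k\<in>{j+1..0}. ?p k) = b + (\<Sum>k\<in>{j+1..-1}. ?p k)" by simp
    then show ?thesis
      using 3 shift[of j "-1"]
      by (simp add: affine_orbit_def matrix_powi_add_1[OF assms] matrix_vector_mul_assoc
          matrix_vector_mult_diff_distrib)
  qed
qed

text \<open>The condition on \<open>c\<close> says that \<open>- c\<close> is a fixed point of the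
  affine map. In coordinates centred there the recursion is linear, so \<open>x j + c\<close> is the
  \<open>j\<close>-th power of \<open>A\<close> applied to \<open>v + c\<close>.\<close>

lemma affine_recursion_fixed_point:
  fixes A :: "real^'n^'n"
  assumes "invertible A"
    and "\<And>j. x (j + 1) = A *v x j + b" "x 0 = v"
    and "A *v c - c = b"
  shows "x j = v + (matrix_powi A j - mat 1) *v (v + c)"
proof (rule affine_recursion_unique[where x = x and b = b, OF assms(1,2)])
  show "v + (matrix_powi A (j + 1) - mat 1) *v (v + c) =
      A *v (v + (matrix_powi A j - mat 1) *v (v + c)) + b" for j
    using assms(4) unfolding matrix_powi_add_1[OF assms(1)]
    by (simp add: matrix_vector_mul_assoc[symmetric]
        matrix_vector_right_distrib matrix_vector_mult_diff_distrib
        matrix_vector_mult_diff_rdistrib algebra_simps)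
qed (use assms in simp)

section \<open>The soliton equation as an affine recursion\<close>

lemma soliton_iff:
  fixes A :: "real^'n^'n"
  assumes "\<alpha> \<noteq> 0"
  shows "soliton \<alpha> A b x \<longleftrightarrow>
    (\<forall>j. x (j + 1) = ((1 / \<alpha>) *\<^sub>R (A + (\<alpha> - 1) *\<^sub>R mat 1)) *v x j + (1 / \<alpha>) *\<^sub>R b)"
proof -
  have scale: "\<alpha> *\<^sub>R u = w \<longleftrightarrow> u = (1 / \<alpha>) *\<^sub>R w" for u w :: "real^'n"
    using assms by auto
  have "midpoint_map \<alpha> x j = A *v x j + b \<longleftrightarrow>
    x (j + 1) = ((1 / \<alpha>) *\<^sub>R (A + (\<alpha> - 1) *\<^sub>R mat 1)) *v x j + (1 / \<alpha>) *\<^sub>R b" for j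
  proof -
    have "midpoint_map \<alpha> x j = A *v x j + b \<longleftrightarrow>
      \<alpha> *\<^sub>R x (j + 1) = (A *v x j + (\<alpha> - 1) *\<^sub>R x j) + b"
      by (auto simp: midpoint_map_def algebra_simps)
    also have "\<dots> \<longleftrightarrow> x (j + 1) = (1 / \<alpha>) *\<^sub>R ((A *v x j + (\<alpha> - 1) *\<^sub>R x j) + b)"
      by (rule scale)
    also have "(1 / \<alpha>) *\<^sub>R ((A *v x j + (\<alpha> - 1) *\<^sub>R x j) + b) =
      ((1 / \<alpha>) *\<^sub>R (A + (\<alpha> - 1) *\<^sub>R mat 1)) *v x j + (1 / \<alpha>) *\<^sub>R b"
      by (simp add: scaleR_matrix_vector_assoc[symmetric] matrix_vector_mult_add_rdistrib
          scaleR_right_distrib)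
    finally show ?thesis .
  qed
  then show ?thesis by (simp add: soliton_def)
qed

section \<open>The matrix series\<close>

text \<open>Bilinear maps are bounded in finite dimension. This and the next lemma give access to
  product rules and to termwise multiplication of series.\<close>

lemma bounded_bilinear_matrix_vector_mult:
  "bounded_bilinear ((*v) :: real^'n^'m \<Rightarrow> real^'n \<Rightarrow> real^'m)"
  unfolding bilinear_conv_bounded_bilinear[symmetric] bilinear_def
  by (auto intro!: linearI simp: matrix_vector_right_distrib matrix_vector_mult_add_rdistrib
      matrix_vector_mult_scaleR scaleR_matrix_vector_assoc[symmetric])

lemma bounded_bilinear_matrix_matrix_mult:
  "bounded_bilinear ((**) :: real^'n^'m \<Rightarrow> real^'k^'n \<Rightarrow> real^'k^'m)"
  unfolding bilinear_conv_bounded_bilinear[symmetric] bilinear_def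
  by (auto intro!: linearI simp: matrix_matrix_mult_def vec_eq_iff sum.distrib algebra_simps
      sum_distrib_left)

lemmas bounded_linear_matrix_mult_left =
  bounded_bilinear.bounded_linear_right[OF bounded_bilinear_matrix_matrix_mult]
lemmas bounded_linear_matrix_mult_right =
  bounded_bilinear.bounded_linear_left[OF bounded_bilinear_matrix_matrix_mult]

lemma matrix_power_commute: "matrix_power B k ** B = B ** matrix_power B k"
  by (induction k) (simp_all add: matrix_mul_assoc[symmetric])

lemma matrix_power_entry_bound:
  fixes B :: "real^'n^'n"
  obtains K where "K \<ge> 1" "\<And>k i j. \<bar>matrix_power B k $ i $ j\<bar> \<le> K ^ k"
proof -
  \<comment> \<open>The cardinality counts the summands in an entry of a matrix product. Adding 1
    ensures \<open>K \<ge> 1\<close>, so that powers of \<open>K\<close> grow with the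
    exponent.\<close>
  define K where "K = real CARD('n) * norm B + 1"
  have B: "\<bar>B $ i $ j\<bar> \<le> norm B" for i j
    by (rule order_trans[OF component_le_norm_cart Finite_Cartesian_Product.norm_nth_le])
  have K0: "K \<ge> 1" by (simp add: K_def)
  have "\<bar>matrix_power B k $ i $ j\<bar> \<le> K ^ k" for k i j
  proof (induction k arbitrary: i j)
    case 0
    then show ?case by (simp add: mat_def)
  next
    case (Suc k)
    have "\<bar>matrix_power B (Suc k) $ i $ j\<bar> \<le> (\<Sum>l\<in>UNIV. \<bar>B $ i $ l * matrix_power B k $ l $ j\<bar>)"
      unfolding matrix_power.simps matrix_matrix_mult_def by (simp add: sum_abs)
    also have "\<dots> \<le> (\<Sum>l\<in>(UNIV::'n set). norm B * K ^ k)"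
      unfolding abs_mult by (intro sum_mono mult_mono B Suc) auto
    also have "\<dots> \<le> K * K ^ k"
      using K0 by (simp add: K_def algebra_simps)
    finally show ?case by simp
  qed
  with K0 show thesis by (rule that)
qed

lemma sums_vecI:
  fixes f :: "nat \<Rightarrow> 'a::real_normed_vector ^ 'n"
  assumes "\<And>i. (\<lambda>k. f k $ i) sums (a $ i)"
  shows "f sums a"
  using assms unfolding sums_def by (intro vec_tendstoI) simp

text \<open>Comparison with the exponential series of \<open>K * \<bar>t\<bar>\<close>. The entries
  are written as genuine power series in \<open>t\<close> with constant term 0, the form needed for
  termwise differentiation.\<close>

lemma F_series_entry_summable:
  fixes B :: "real^'n^'n" and t :: real
  defines "c \<equiv> \<lambda>i j n. (if n = 0 then 0 else matrix_power B (n - 1) $ i $ j / fact n)"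
  shows "summable (\<lambda>n. c i j n * t ^ n)"
proof -
  obtain K where K: "K \<ge> 1" "\<And>k i j. \<bar>matrix_power B k $ i $ j\<bar> \<le> K ^ k"
    using matrix_power_entry_bound[of B] by blast
  have "\<bar>c i j n\<bar> \<le> K ^ n / fact n" for n
  proof (cases n)
    case 0
    then show ?thesis by (simp add: c_def)
  next
    case (Suc m)
    have "K ^ m \<le> K ^ n"
      using K(1) Suc by (intro power_increasing) auto
    with K(2) have "\<bar>matrix_power B m $ i $ j\<bar> \<le> K ^ n"
      by (rule order_trans)
    then show ?thesis using Suc by (simp add: c_def abs_divide divide_right_mono del: fact_Suc power_Suc)
  qed
  then have "norm (c i j n * t ^ n) \<le> (K * \<bar>t\<bar>) ^ n /\<^sub>R fact n" for n
    using mult_right_mono[of "\<bar>c i j n\<bar>" "K ^ n / fact n" "\<bar>t\<bar> ^ n"]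
    by (simp add: abs_mult power_abs power_mult_distrib field_simps)
  then show ?thesis
    by (rule summable_comparison_test'[OF summable_exp_generic, of 0])
qed

lemma F_series_entry_sums:
  fixes B :: "real^'n^'n" and t :: real
  shows "(\<lambda>k. ((t ^ Suc k / fact (Suc k)) *\<^sub>R matrix_power B k) $ i $ j) sums
    (\<Sum>n. (if n = 0 then 0 else matrix_power B (n - 1) $ i $ j / fact n) * t ^ n)"
proof -
  let ?f = "\<lambda>n. (if n = 0 then 0 else matrix_power B (n - 1) $ i $ j / fact n) * t ^ n"
  \<comment> \<open>The summand \<open>?f 0\<close> is 0; it is added to match the index shift of
    \<open>sums_Suc_iff\<close>.\<close>
  have "?f sums ((\<Sum>n. ?f n) + ?f 0)"
    using summable_sums[OF F_series_entry_summable[of B i j t]] by simp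
  then have "(\<lambda>k. ?f (Suc k)) sums (\<Sum>n. ?f n)"
    by (rule iffD2[OF sums_Suc_iff])
  moreover have "?f (Suc k) = ((t ^ Suc k / fact (Suc k)) *\<^sub>R matrix_power B k) $ i $ j" for k
    by simp
  ultimately show ?thesis by (simp only:)
qed

text \<open>Entrywise convergence yields convergence of the matrix series, so the infinite sum
  defining \<open>F_series\<close> is a true limit.\<close>

lemma F_series_sums:
  "(\<lambda>k. (t ^ Suc k / fact (Suc k)) *\<^sub>R matrix_power B k) sums F_series B t"
proof -
  have "(\<lambda>k. (t ^ Suc k / fact (Suc k)) *\<^sub>R matrix_power B k) sums
    (\<chi> i j. \<Sum>n. (if n = 0 then 0 else matrix_power B (n - 1) $ i $ j / fact n) * t ^ n)"
    by (intro sums_vecI) (use F_series_entry_sums[of t B] in simp)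
  then show ?thesis by (simp add: F_series_def sums_iff)
qed

lemma F_series_nth:
  "F_series B t $ i $ j =
    (\<Sum>n. (if n = 0 then 0 else matrix_power B (n - 1) $ i $ j / fact n) * t ^ n)"
  using sums_unique2[OF sums_vec_nth[OF sums_vec_nth[OF F_series_sums]] F_series_entry_sums] .

lemma F_series_0 [simp]: "F_series B 0 = 0"
  by (simp add: F_series_def)

text \<open>Every term of the series commutes with \<open>B\<close>, and multiplication by
  \<open>B\<close> on either side is continuous.\<close>

lemma F_series_commute: "F_series B t ** B = B ** F_series B t"
proof -
  have "(\<lambda>k. ((t ^ Suc k / fact (Suc k)) *\<^sub>R matrix_power B k) ** B) sums (F_series B t ** B)"
    by (rule bounded_linear.sums[OF bounded_linear_matrix_mult_right F_series_sums])
  moreover have "(\<lambda>k. B ** ((t ^ Suc k / fact (Suc k)) *\<^sub>R matrix_power B k)) sums (B ** F_series B t)"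
    by (rule bounded_linear.sums[OF bounded_linear_matrix_mult_left F_series_sums])
  moreover have "((t ^ Suc k / fact (Suc k)) *\<^sub>R matrix_power B k) ** B =
      B ** ((t ^ Suc k / fact (Suc k)) *\<^sub>R matrix_power B k)" for k
    by (simp only: bounded_bilinear.scaleR_left[OF bounded_bilinear_matrix_matrix_mult]
        bounded_bilinear.scaleR_right[OF bounded_bilinear_matrix_matrix_mult] matrix_power_commute)
  ultimately show ?thesis by (simp add: sums_iff)
qed

text \<open>Multiplying the series of \<open>F_series\<close> by \<open>B\<close> gives the
  exponential series of \<open>t B\<close> without its term at \<open>k = 0\<close>, which is
  \<open>mat 1\<close>.\<close>

lemma matrix_exp_series_sums:
  "(\<lambda>k. (t ^ k / fact k) *\<^sub>R matrix_power B k) sums (mat 1 + B ** F_series B t)"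
proof -
  have "(\<lambda>k. B ** ((t ^ Suc k / fact (Suc k)) *\<^sub>R matrix_power B k)) sums (B ** F_series B t)"
    by (rule bounded_linear.sums[OF bounded_linear_matrix_mult_left F_series_sums])
  then have "(\<lambda>k. (t ^ Suc k / fact (Suc k)) *\<^sub>R matrix_power B (Suc k)) sums (B ** F_series B t)"
    by (simp add: bounded_bilinear.scaleR_right[OF bounded_bilinear_matrix_matrix_mult]
        del: fact_Suc power_Suc)
  from sums_Suc[OF this] show ?thesis by (simp add: add.commute)
qed

lemma matrix_exp_eq: "matrix_exp B = mat 1 + B ** F_series B 1"
  using matrix_exp_series_sums[of 1 B] by (simp add: matrix_exp_def sums_iff)

text \<open>Each entry is differentiated as a power series: \<open>diffs\<close> turns its
  coefficients into those of the exponential of \<open>t B\<close>.\<close>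

lemma F_series_has_vector_derivative:
  "((F_series B) has_vector_derivative (mat 1 + B ** F_series B t)) (at t within S)"
proof -
  have "((\<lambda>s. F_series B s $ i $ j) has_field_derivative (mat 1 + B ** F_series B t) $ i $ j)
      (at t within S)" for i j
  proof -
    let ?c = "\<lambda>n. (if n = 0 then 0 else matrix_power B (n - 1) $ i $ j / fact n)"
    have "((\<lambda>s. \<Sum>n. ?c n * s ^ n) has_field_derivative (\<Sum>n. diffs ?c n * t ^ n)) (at t)"
      by (intro termdiffs_strong_converges_everywhere F_series_entry_summable)
    moreover have "diffs ?c = (\<lambda>n. matrix_power B n $ i $ j / fact n)"
      by (auto simp: diffs_def fun_eq_iff field_simps simp del: of_nat_Suc)
    moreover have "(\<Sum>n. matrix_power B n $ i $ j / fact n * t ^ n) = (mat 1 + B ** F_series B t) $ i $ j"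
      using sums_vec_nth[OF sums_vec_nth[OF matrix_exp_series_sums[of t B]], of i j]
      by (simp add: sums_iff field_simps)
    ultimately show ?thesis
      by (auto simp: F_series_nth intro: DERIV_subset)
  qed
  then show ?thesis
    unfolding has_vector_derivative_def has_field_derivative_def
    by (subst has_derivative_componentwise_within)
      (auto simp: Basis_vec_def inner_axis mult_commute_abs)
qed

section \<open>The linear differential equation and the curve\<close>

text \<open>Uniqueness for \<open>h' = B h\<close>: the quantity \<open>exp (-t B) h(t)\<close> is constant, and so is
  \<open>exp (-t B) exp (t B)\<close>, so the constant can be read off at \<open>0\<close>.\<close>

lemma linear_ode_zero:
  fixes B :: "real^'n^'n"
  assumes "\<And>t. (h has_vector_derivative B *v h t) (at t)" "h 0 = 0"
  shows "h t = 0"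
proof -
  have zero_derivative: "f t = f 0"
    if f': "\<And>t. (f has_vector_derivative 0) (at t)" for f :: "real \<Rightarrow> 'b::real_normed_vector" and t
  proof -
    obtain c where "\<And>s. s \<in> UNIV \<Longrightarrow> f s = c"
      using has_vector_derivative_zero_constant[of UNIV f, OF convex_UNIV f'] by blast
    then show ?thesis by simp
  qed
  \<comment> \<open>By \<open>matrix_exp_series_sums\<close>, \<open>E t\<close> is the exponential
    of \<open>t B\<close>.\<close>
  define E where "E t = mat 1 + B ** F_series B t" for t
  have E: "(E has_vector_derivative B ** E t) (at t)" for t
    unfolding E_def
    by (rule derivative_eq_intros bounded_linear.has_vector_derivative[OF
          bounded_linear_matrix_mult_left] F_series_has_vector_derivative refl | simp)+
  have Em: "((\<lambda>s. E (-s)) has_vector_derivative - (B ** E (-t))) (at t)" for t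
  proof -
    have "((\<lambda>s::real. - s) has_vector_derivative - 1) (at t)"
      by (rule has_vector_derivative_minus) (rule has_vector_derivative_id)
    from vector_diff_chain_at[OF this E] show ?thesis by (simp add: o_def)
  qed
  have comm: "E t ** B = B ** E t" for t
    by (simp add: E_def matrix_add_ldistrib
        bounded_bilinear.add_left[OF bounded_bilinear_matrix_matrix_mult] F_series_commute
        matrix_mul_assoc[symmetric])
  have E0: "E 0 = mat 1" by (simp add: E_def)
  have "((\<lambda>s. E (-s) *v h s) has_vector_derivative 0) (at t)" for t
    using bounded_bilinear.has_vector_derivative[OF bounded_bilinear_matrix_vector_mult Em assms(1)]
    by (simp add: matrix_vector_mul_assoc comm
        bounded_bilinear.minus_left[OF bounded_bilinear_matrix_vector_mult])
  from zero_derivative[OF this, of t] have "E (-t) *v h t = E (-0) *v h 0" .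
  then have 1: "E (-t) *v h t = 0" using assms(2) by simp
  have "((\<lambda>s. E s ** E (-s)) has_vector_derivative 0) (at t)" for t
    using bounded_bilinear.has_vector_derivative[OF bounded_bilinear_matrix_matrix_mult E Em]
    by (simp add: matrix_mul_assoc comm
        bounded_bilinear.minus_right[OF bounded_bilinear_matrix_matrix_mult])
  from zero_derivative[OF this, of t] have "E t ** E (-t) = E 0 ** E (-0)" .
  then have "E t ** E (-t) = mat 1" by (simp add: E0)
  then have "h t = E t *v (E (-t) *v h t)" by (simp add: matrix_vector_mul_assoc)
  with 1 show ?thesis by simp
qed

text \<open>Curves of this shape are closed under differentiation: \<open>p\<close> becomes
  \<open>M *v w\<close> and \<open>M\<close> becomes \<open>M ** B\<close>. The general
  \<open>M\<close> is what lets the induction over derivatives go through.\<close>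

lemma F_series_curve_has_vector_derivative:
  "((\<lambda>t. p + M *v (F_series B t *v w)) has_vector_derivative
    M *v w + (M ** B) *v (F_series B t *v w)) (at t)"
proof -
  have "((\<lambda>t. F_series B t *v w) has_vector_derivative (mat 1 + B ** F_series B t) *v w) (at t)"
    by (intro bounded_linear.has_vector_derivative[OF bounded_bilinear.bounded_linear_left[OF
          bounded_bilinear_matrix_vector_mult]] F_series_has_vector_derivative)
  from bounded_linear.has_vector_derivative[OF matrix_vector_mul_bounded_linear this, of M]
  have "((\<lambda>t. p + M *v (F_series B t *v w)) has_vector_derivative
    0 + M *v ((mat 1 + B ** F_series B t) *v w)) (at t)"
    by (intro has_vector_derivative_add has_vector_derivative_const)
  then show ?thesis
    by (simp add: matrix_vector_mult_add_rdistrib matrix_vector_right_distrib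
        matrix_vector_mul_assoc matrix_mul_assoc)
qed

lemma smooth_curve_F_series: "smooth_curve (\<lambda>t. v + F_series B t *v w)"
proof -
  have "\<exists>p M. ((\<lambda>f s. vector_derivative f (at s)) ^^ k) (\<lambda>t. v + F_series B t *v w) =
      (\<lambda>t. p + M *v (F_series B t *v w))" for k
  proof (induction k)
    case 0
    show ?case by (intro exI[of _ v] exI[of _ "mat 1"]) simp
  next
    case (Suc k)
    then obtain p M where
      "((\<lambda>f s. vector_derivative f (at s)) ^^ k) (\<lambda>t. v + F_series B t *v w) =
        (\<lambda>t. p + M *v (F_series B t *v w))" by blast
    then show ?case
      by (intro exI[of _ "M *v w"] exI[of _ "M ** B"])
        (simp add: vector_derivative_at[OF F_series_curve_has_vector_derivative])
  qed
  then show ?thesis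
    unfolding smooth_curve_def
    by (metis F_series_curve_has_vector_derivative differentiableI_vector)
qed

text \<open>The curve solves \<open>c' = B c + d\<close>. Its defect \<open>h\<close> in the
  recursion satisfies \<open>h' = B h\<close>, because the exponential of \<open>B\<close> commutes
  with \<open>B\<close> and sends \<open>d\<close> to
  \<open>d + B *v (F_series B 1 *v d)\<close>.\<close>

lemma F_series_curve_add_1:
  fixes B :: "real^'n^'n" and v d :: "real^'n"
  defines "c \<equiv> \<lambda>t. v + F_series B t *v (B *v v + d)"
  shows "c (t + 1) = matrix_exp B *v c t + F_series B 1 *v d"
proof -
  define w where "w = B *v v + d"
  define A where "A = matrix_exp B"
  define h where "h t = c (t + 1) - (A *v c t + F_series B 1 *v d)" for t
  have A: "A = mat 1 + B ** F_series B 1" by (simp add: A_def matrix_exp_eq)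
  have AB: "A ** B = B ** A"
    by (simp add: A matrix_add_ldistrib
        bounded_bilinear.add_left[OF bounded_bilinear_matrix_matrix_mult] F_series_commute
        matrix_mul_assoc[symmetric])
  \<comment> \<open>This identity is the recursion at time 0 and yields
    \<open>h 0 = 0\<close>.\<close>
  have Av: "A *v v + F_series B 1 *v d = v + F_series B 1 *v w"
    by (simp add: A w_def matrix_vector_mult_add_rdistrib matrix_vector_right_distrib
        matrix_vector_mul_assoc F_series_commute)
  have c': "(c has_vector_derivative B *v c t + d) (at t)" for t
    using F_series_curve_has_vector_derivative[of v "mat 1" B w t]
    by (simp add: c_def w_def[symmetric])
      (simp add: w_def matrix_vector_right_distrib algebra_simps)
  have c1: "((\<lambda>t. c (t + 1)) has_vector_derivative B *v c (t + 1) + d) (at t)" for t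
  proof -
    have "((\<lambda>t::real. t + 1) has_vector_derivative 1 + 0) (at t)"
      by (intro has_vector_derivative_add has_vector_derivative_id has_vector_derivative_const)
    from vector_diff_chain_at[OF this c'] show ?thesis by (simp add: o_def)
  qed
  have Ad: "A *v d = d + B *v (F_series B 1 *v d)"
    by (simp add: A matrix_vector_mult_add_rdistrib matrix_vector_mul_assoc)
  have "(h has_vector_derivative B *v h t) (at t)" for t
  proof -
    have "(h has_vector_derivative B *v c (t + 1) + d - (A *v (B *v c t + d) + 0)) (at t)"
      unfolding h_def
      by (intro has_vector_derivative_diff has_vector_derivative_add has_vector_derivative_const c1
          bounded_linear.has_vector_derivative[OF matrix_vector_mul_bounded_linear c'])
    moreover have "A *v (B *v c t) = B *v (A *v c t)"
      by (simp add: matrix_vector_mul_assoc AB)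
    ultimately show ?thesis
      by (simp add: h_def Ad matrix_vector_right_distrib matrix_vector_mult_diff_distrib
          algebra_simps)
  qed
  moreover have "h 0 = 0"
    by (simp add: h_def c_def Av w_def[symmetric])
  ultimately have "h t = 0" by (rule linear_ode_zero)
  then show ?thesis by (simp add: h_def A_def)
qed

text \<open>Each formula containing a further inverse carries the existence of that inverse as a
  premise; the formulas by sums hold without such a premise.\<close>

theorem theorem1:
  fixes A A\<^sub>\<alpha> :: "real ^ 'n ^ 'n" and b b\<^sub>\<alpha> v :: "real ^ 'n" and \<alpha> :: real
  assumes "0 < \<alpha>" and "\<alpha> < 1"
    and "\<not> eigenvalue A (1 - \<alpha>)"
    and "A\<^sub>\<alpha> = (1 / \<alpha>) *\<^sub>R (A + (\<alpha> - 1) *\<^sub>R mat 1)"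
    and "b\<^sub>\<alpha> = (1 / \<alpha>) *\<^sub>R b"
  shows "invertible A\<^sub>\<alpha> \<and>
    (\<exists>!x. x 0 = v \<and> soliton \<alpha> A b x) \<and>
    (\<forall>x. x 0 = v \<and> soliton \<alpha> A b x \<longrightarrow>
      (\<forall>j>0.
        x j = matrix_powi A\<^sub>\<alpha> j *v v + (\<Sum>k\<in>{0..j-1}. matrix_powi A\<^sub>\<alpha> k *v b\<^sub>\<alpha>) \<and>
        (invertible (A\<^sub>\<alpha> - mat 1) \<longrightarrow>
          x j = v + (matrix_powi A\<^sub>\<alpha> j - mat 1) *v (v + matrix_inv (A\<^sub>\<alpha> - mat 1) *v b\<^sub>\<alpha>))) \<and>
      (\<forall>j<0.
        x j = matrix_powi A\<^sub>\<alpha> j *v v - (\<Sum>k\<in>{j..-1}. matrix_powi A\<^sub>\<alpha> k *v b\<^sub>\<alpha>) \<and>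
        (invertible (matrix_inv A\<^sub>\<alpha> - mat 1) \<longrightarrow>
          x j = v + (matrix_powi A\<^sub>\<alpha> j - mat 1) *v
            (v - matrix_inv (matrix_inv A\<^sub>\<alpha> - mat 1) *v (matrix_inv A\<^sub>\<alpha> *v b\<^sub>\<alpha>)))) \<and>
      (\<forall>B\<^sub>\<alpha> d\<^sub>\<alpha>. A\<^sub>\<alpha> = matrix_exp B\<^sub>\<alpha> \<and> b\<^sub>\<alpha> = F_series B\<^sub>\<alpha> 1 *v d\<^sub>\<alpha> \<longrightarrow>
        smooth_curve (\<lambda>t. v + F_series B\<^sub>\<alpha> t *v (B\<^sub>\<alpha> *v v + d\<^sub>\<alpha>)) \<and>
        (\<forall>j. x j = v + F_series B\<^sub>\<alpha> (of_int j) *v (B\<^sub>\<alpha> *v v + d\<^sub>\<alpha>))))"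
proof -
  let ?A = "A\<^sub>\<alpha>" and ?b = "b\<^sub>\<alpha>"
  have inv: "invertible ?A"
    unfolding invertible_iff_ker_trivial
  proof (intro allI impI)
    \<comment> \<open>A nonzero kernel vector would be an eigenvector of \<open>A\<close> for the
      excluded value \<open>1 - \<alpha>\<close>.\<close>
    fix w assume "?A *v w = 0"
    then have "(1 / \<alpha>) *\<^sub>R (A *v w + (\<alpha> - 1) *\<^sub>R w) = 0"
      by (simp add: assms(4) scaleR_matrix_vector_assoc[symmetric] matrix_vector_mult_add_rdistrib
          scaleR_right_distrib)
    then have "A *v w + (\<alpha> - 1) *\<^sub>R w = 0" using assms(1) by simp
    then have "A *v w = (1 - \<alpha>) *\<^sub>R w" by (simp add: algebra_simps)
    then show "w = 0" using assms(3) by (auto simp: eigenvalue_def)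
  qed
  have sol: "soliton \<alpha> A b x \<longleftrightarrow> (\<forall>j. x (j + 1) = ?A *v x j + ?b)" for x
    using soliton_iff[of \<alpha>] assms(1,4,5) by simp
  have orbit: "x j = affine_orbit ?A ?b v j" if "x 0 = v" "soliton \<alpha> A b x" for x j
    by (rule affine_recursion_unique[OF inv, where x = x and b = ?b and j = j])
      (use that in \<open>simp_all add: sol affine_orbit_add_1[OF inv]\<close>)
  have ex1: "\<exists>!x. x 0 = v \<and> soliton \<alpha> A b x"
  proof (rule ex1I)
    show "affine_orbit ?A ?b v 0 = v \<and> soliton \<alpha> A b (affine_orbit ?A ?b v)"
      by (simp add: sol affine_orbit_add_1[OF inv])
  qed (use orbit in blast)
  have pos: "x j = v + (matrix_powi ?A j - mat 1) *v (v + matrix_inv (?A - mat 1) *v ?b)"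
    if "x 0 = v" "soliton \<alpha> A b x" "invertible (?A - mat 1)" for x j
  proof (rule affine_recursion_fixed_point[OF inv, where x = x and b = ?b and j = j])
    have "(?A - mat 1) *v (matrix_inv (?A - mat 1) *v ?b) = ?b"
      by (simp add: matrix_vector_mul_assoc matrix_inv_cancel[OF that(3)])
    then show "?A *v (matrix_inv (?A - mat 1) *v ?b) - matrix_inv (?A - mat 1) *v ?b = ?b"
      by (simp add: matrix_vector_mult_diff_rdistrib)
  qed (use that sol in simp_all)
  have neg: "x j = v + (matrix_powi ?A j - mat 1) *v
      (v - matrix_inv (matrix_inv ?A - mat 1) *v (matrix_inv ?A *v ?b))"
    if "x 0 = v" "soliton \<alpha> A b x" "invertible (matrix_inv ?A - mat 1)" for x j
  proof -
    \<comment> \<open>The choice \<open>c = - e\<close> fits the fixed point lemma: multiplying the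
      equation defining \<open>e\<close> by \<open>A\<^sub>\<alpha>\<close> gives
      \<open>e - A\<^sub>\<alpha> *v e = b\<^sub>\<alpha>\<close>.\<close>
    define e where "e = matrix_inv (matrix_inv ?A - mat 1) *v (matrix_inv ?A *v ?b)"
    have "(matrix_inv ?A - mat 1) *v e = matrix_inv ?A *v ?b"
      unfolding e_def by (simp add: matrix_vector_mul_assoc matrix_inv_cancel[OF that(3)] matrix_mul_assoc)
    then have "?A *v ((matrix_inv ?A - mat 1) *v e) = ?A *v (matrix_inv ?A *v ?b)"
      by simp
    then have "e - ?A *v e = ?b"
      by (simp add: matrix_vector_mult_diff_rdistrib matrix_vector_mult_diff_distrib)
        (simp add: matrix_vector_mul_assoc matrix_inv_cancel[OF inv])
    then have "?A *v (- e) - (- e) = ?b"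
      by (simp add: bounded_bilinear.minus_right[OF bounded_bilinear_matrix_vector_mult])
    from affine_recursion_fixed_point[where x = x and j = j, OF inv _ that(1) this] show ?thesis
      using that(2) sol unfolding e_def by simp
  qed
  have curve: "x j = v + F_series B (of_int j) *v (B *v v + d)"
    if "x 0 = v" "soliton \<alpha> A b x" "?A = matrix_exp B" "?b = F_series B 1 *v d" for x j B d
  proof (rule affine_recursion_unique[OF inv, where x = x and b = ?b and j = j])
    show "v + F_series B (of_int (j + 1)) *v (B *v v + d) =
        ?A *v (v + F_series B (of_int j) *v (B *v v + d)) + ?b" for j
      using F_series_curve_add_1[of v B "of_int j" d] that(3,4) by simp
  qed (use that sol in simp_all)
  show ?thesis
  proof (intro conjI allI impI; (elim conjE)?)
    show "invertible ?A" by (fact inv)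
    show "\<exists>!x. x 0 = v \<and> soliton \<alpha> A b x" by (fact ex1)
  next
    fix x :: "int \<Rightarrow> real^'n" and j :: int
    assume x: "x 0 = v" "soliton \<alpha> A b x" and "0 < j"
    then show "x j = matrix_powi ?A j *v v + (\<Sum>k\<in>{0..j-1}. matrix_powi ?A k *v ?b)"
      by (simp add: orbit affine_orbit_def)
  next
    fix x :: "int \<Rightarrow> real^'n" and j :: int
    assume x: "x 0 = v" "soliton \<alpha> A b x" and "j < 0"
    then show "x j = matrix_powi ?A j *v v - (\<Sum>k\<in>{j..-1}. matrix_powi ?A k *v ?b)"
      by (simp add: orbit affine_orbit_def)
  qed (use pos neg curve smooth_curve_F_series in \<open>blast+\<close>)
qed

end
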